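(* Let $a \geq 2$ and $n$ be positive integers, and let $\chi:[1,n]\to\{\text{red},\text{blue}\}$ be a 2-coloring. Let $Q$ be two times the number of triples $(x,y,z)$ of integers in $[1,n]$ with $x+ay=z$ that are not monochromatic (i.e. $\chi(x),\chi(y),\chi(z)$ are not all equal). Then $$Q \leq \frac{n^2}{a}\left(1-\frac{1}{a^2+2a+3}\right).$$
   Context: $[1,n]$ denotes the set of integers $\{1,2,\dots,n\}$. *)

theory Defs
  imports Complex_Main
begin

(* A 2-coloring of [1,n] is represented by a total function on nat; the definition below
   only inspects its values on {1..n}. *)
datatype color = Red | Blue

definition non_monochromatic_triples ::
    "nat \<Rightarrow> nat \<Rightarrow> (nat \<Rightarrow> color) \<Rightarrow> (nat \<times> nat \<times> nat) set" where
  "non_monochromatic_triples a n \<chi> =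
     {(x, y, z). x \<in> {1..n} \<and> y \<in> {1..n} \<and> z \<in> {1..n} \<and> x + a * y = z \<and>
        \<not> (\<chi> x = \<chi> y \<and> \<chi> y = \<chi> z)}"

end

theory Submission
  imports Defs
begin

text \<open>A triple that is not monochromatic contains exactly two bichromatic pairs, so \<open>Q\<close> counts
  bichromatic pairs. Let \<open>a\<close> divide \<open>n\<close>, encode the colours by signs \<open>s\<close>, and assume that at most
  half of \<open>{1..n}\<close> is red. The pairs \<open>(x, z)\<close>, which agree modulo \<open>a\<close>, are bounded by Cauchy-Schwarz
  over the residue classes. The pairs containing \<open>y\<close> depend only on \<open>s y\<close> and on the
  drift \<open>d t\<close>, the sum of the signs over the window \<open>(t, n - t]\<close>, at \<open>t = a * y\<close>. Up to lower order
  terms this gives \<open>a * Q \<le> n\<^sup>2 - (e\<^sup>2 + m * (n - m) + a / 2 * (\<Sum>y. s y * d (a * y)))\<close>, where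
  \<open>m\<close> is \<open>a\<close> times the number \<open>\<mu>\<close> of red \<open>y \<le> n / a\<close>, and \<open>e = n - r - m\<close> with \<open>r\<close> the number of reds.

  The drift satisfies \<open>d (n - t) = - d t\<close>, and counting reds in the window bounds \<open>\<bar>d t\<bar>\<close> by an explicit
  envelope. Summing the largest values of the envelope bounds the bracket below by
  \<open>e\<^sup>2 + \<mu>\<^sup>2 + \<nu>\<^sup>2\<close> in the critical case, with \<open>\<nu> = r - \<mu>\<close>. Since \<open>e + (a + 1) * \<mu> + \<nu> = n\<close>,
  Cauchy-Schwarz yields \<open>n\<^sup>2 / ((a + 1)\<^sup>2 + 1 + 1)\<close>.\<close>

subsection \<open>Non-monochromatic triples and autocorrelations\<close>

text \<open>The off-diagonal products are grouped by their lag \<open>y\<close>. The lag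
  \<open>M\<close> carries an empty sum and is included to match the range of \<open>y\<close> in a
  triple.\<close>

lemma square_sum_eq_autocorrelation:
  fixes f :: "nat \<Rightarrow> real"
  shows "(\<Sum>j<M. f j)\<^sup>2 = (\<Sum>j<M. (f j)\<^sup>2) + 2 * (\<Sum>y=1..M. \<Sum>i<M - y. f i * f (i + y))"
proof (induction M)
  case 0
  then show ?case by simp
next
  case (Suc M)
  have "(\<Sum>i<Suc M - y. f i * f (i + y)) = (\<Sum>i<M - y. f i * f (i + y)) + f (M - y) * f M"
    if "y \<in> {1..M}" for y
    using that by (simp add: Suc_diff_le)
  then have "(\<Sum>y=1..Suc M. \<Sum>i<Suc M - y. f i * f (i + y))
      = (\<Sum>y=1..M. (\<Sum>i<M - y. f i * f (i + y)) + f (M - y) * f M)"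
    by simp
  also have "\<dots> = (\<Sum>y=1..M. \<Sum>i<M - y. f i * f (i + y)) + (\<Sum>y=1..M. f (M - y)) * f M"
    by (simp add: sum.distrib sum_distrib_right)
  also have "(\<Sum>y=1..M. f (M - y)) = (\<Sum>j<M. f j)"
    by (rule sum.reindex_bij_witness[of _ "\<lambda>j. M - j" "\<lambda>y. M - y"]) auto
  finally show ?case
    using Suc.IH by (simp add: power2_eq_square algebra_simps)
qed

lemma sum_residue_classes:
  fixes f :: "nat \<Rightarrow> real"
  shows "(\<Sum>x=1..a * M. f x) = (\<Sum>c<a. \<Sum>j<M. f (c + 1 + a * j))"
proof -
  have block: "(\<Sum>x=j * a..<j * a + a. f (Suc x)) = (\<Sum>c<a. f (c + 1 + a * j))" for j
    by (rule sum.reindex_bij_witness[of _ "\<lambda>c. c + j * a" "\<lambda>x. x - j * a"])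
      (auto simp: algebra_simps)
  have "(\<Sum>x=1..a * M. f x) = (\<Sum>x<M * a. f (Suc x))"
    by (rule sum.reindex_bij_witness[of _ Suc "\<lambda>x. x - 1"]) (auto simp: mult.commute)
  also have "\<dots> = (\<Sum>j<M. \<Sum>x=j * a..<j * a + a. f (Suc x))"
    by (rule sum.nat_group[symmetric])
  also have "\<dots> = (\<Sum>j<M. \<Sum>c<a. f (c + 1 + a * j))"
    by (simp only: block)
  also have "\<dots> = (\<Sum>c<a. \<Sum>j<M. f (c + 1 + a * j))"
    by (rule sum.swap)
  finally show ?thesis .
qed

text \<open>Since \<open>x\<close> and \<open>x + a * y\<close> share a residue class modulo
  \<open>a\<close>, the bracket on the right is the sum of squares of the \<open>a\<close> class
  sums; Cauchy-Schwarz compares it with the square of their total.\<close>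

lemma autocorrelation_lower_bound:
  fixes s :: "nat \<Rightarrow> real"
  assumes "a > 0" and s: "\<And>i. s i = 1 \<or> s i = -1"
  shows "(\<Sum>x=1..a * M. s x)\<^sup>2
    \<le> a * (a * M + 2 * (\<Sum>y=1..M. \<Sum>x=1..a * M - a * y. s x * s (x + a * y)))"
proof -
  define T where "T c = (\<Sum>j<M. s (c + 1 + a * j))" for c
  define S where "S = (\<Sum>c<a. T c)"
  have sq: "(s i)\<^sup>2 = 1" for i
    using s[of i] by auto
  have "(\<Sum>y=1..M. \<Sum>x=1..a * M - a * y. s x * s (x + a * y))
      = (\<Sum>y=1..M. \<Sum>c<a. \<Sum>i<M - y. s (c + 1 + a * i) * s (c + 1 + a * (i + y)))"
    unfolding diff_mult_distrib2[symmetric] sum_residue_classes by (simp add: algebra_simps)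
  also have "\<dots> = (\<Sum>c<a. \<Sum>y=1..M. \<Sum>i<M - y. s (c + 1 + a * i) * s (c + 1 + a * (i + y)))"
    by (rule sum.swap)
  finally have "a * M + 2 * (\<Sum>y=1..M. \<Sum>x=1..a * M - a * y. s x * s (x + a * y)) = (\<Sum>c<a. (T c)\<^sup>2)"
    unfolding T_def by (simp add: square_sum_eq_autocorrelation sq sum.distrib sum_distrib_left)
  moreover have "S\<^sup>2 \<le> a * (\<Sum>c<a. (T c)\<^sup>2)"
  proof -
    \<comment> \<open>Cauchy-Schwarz in variance form: the deviations of \<open>a * T c\<close> from
      the total \<open>S\<close>.\<close>
    have "0 \<le> (\<Sum>c<a. (a * T c - S)\<^sup>2)"
      by (intro sum_nonneg) simp
    also have "\<dots> = (\<Sum>c<a. a\<^sup>2 * (T c)\<^sup>2 - 2 * a * S * T c + S\<^sup>2)"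
      by (intro sum.cong refl) (simp add: power2_eq_square algebra_simps)
    also have "\<dots> = a\<^sup>2 * (\<Sum>c<a. (T c)\<^sup>2) - 2 * a * S * (\<Sum>c<a. T c) + a * S\<^sup>2"
      by (simp add: sum.distrib sum_subtractf sum_distrib_left)
    also have "\<dots> = a * (a * (\<Sum>c<a. (T c)\<^sup>2) - S\<^sup>2)"
      by (simp add: S_def[symmetric] power2_eq_square algebra_simps)
    finally show ?thesis
      using \<open>a > 0\<close> by (simp add: zero_le_mult_iff)
  qed
  moreover have "(\<Sum>x=1..a * M. s x) = S"
    unfolding S_def T_def by (rule sum_residue_classes)
  ultimately show ?thesis
    by simp
qed

lemma card_filter_eq_sum:
  assumes "finite A"
  shows "real (card {p \<in> A. R p}) = (\<Sum>p\<in>A. of_bool (R p))"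
  using assms by (simp add: Int_def flip: of_bool_def)

text \<open>The three pairwise products of signs add up to 3 on a monochromatic triple and to -1 on
  any other, so a quarter of 3 minus this sum is the indicator; the factor 2 turns the quarter into
  a half.\<close>

lemma card_non_monochromatic_triples_multiple:
  fixes \<chi> :: "nat \<Rightarrow> color" and s :: "nat \<Rightarrow> real"
  assumes "a > 0" and s: "\<And>i. s i = 1 \<or> s i = -1"
    and s_eq: "\<And>i j. \<chi> i = \<chi> j \<longleftrightarrow> s i = s j"
  shows "2 * real (card (non_monochromatic_triples a (a * M) \<chi>))
    = (\<Sum>y=1..M. \<Sum>x=1..a * M - a * y.
        (3 - s x * s y - s y * s (x + a * y) - s x * s (x + a * y)) / 2)"
proof -
  define U where "U = (SIGMA y:{1..M}. {1..a * M - a * y})"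
  define R where "R = (\<lambda>(y, x). \<not> (\<chi> x = \<chi> y \<and> \<chi> y = \<chi> (x + a * y)))"
  have weight: "of_bool (R (y, x)) = (3 - s x * s y - s y * s (x + a * y) - s x * s (x + a * y)) / (4 :: real)" for x y
    using s[of x] s[of y] s[of "x + a * y"] by (auto simp: R_def s_eq)
  have "card (non_monochromatic_triples a (a * M) \<chi>) = card {p \<in> U. R p}"
  proof (rule bij_betw_same_card[of "\<lambda>(x, y, z). (y, x)"], rule bij_betw_byWitness[of _ "\<lambda>(y, x). (x, y, x + a * y)"])
    have "y \<le> M" if "x + a * y \<le> a * M" for x y
      using that \<open>a > 0\<close> by (metis add_leD2 mult_le_cancel1)
    then show "(\<lambda>(x, y, z). (y, x)) ` non_monochromatic_triples a (a * M) \<chi> \<subseteq> {p \<in> U. R p}"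
      by (auto simp: non_monochromatic_triples_def U_def R_def)
    have "y \<le> a * M" if "x + a * y \<le> a * M" for x y
      using that \<open>a > 0\<close> by (metis add_leD2 le_trans mult.commute nat_mult_le_cancel1 mult_le_mono1 One_nat_def Suc_leI nat_mult_1)
    moreover have "x + a * y \<le> a * M" if "x \<le> a * M - a * y" "x \<ge> 1" for x y
      using that by linarith
    ultimately show "(\<lambda>(y, x). (x, y, x + a * y)) ` {p \<in> U. R p} \<subseteq> non_monochromatic_triples a (a * M) \<chi>"
      by (fastforce simp: non_monochromatic_triples_def U_def R_def)
  qed (auto simp: non_monochromatic_triples_def)
  also have "real \<dots> = (\<Sum>p\<in>U. of_bool (R p))"
    by (rule card_filter_eq_sum) (simp add: U_def)
  also have "\<dots> = (\<Sum>y=1..M. \<Sum>x=1..a * M - a * y. of_bool (R (y, x)))"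
    unfolding U_def by (subst sum.Sigma) (auto simp only: finite_atLeastAtMost split_def prod.collapse)
  finally show ?thesis
    unfolding weight by (auto simp: sum_distrib_left field_simps intro!: sum.cong)
qed

subsection \<open>The quadratic optimisation problem\<close>

lemma cauchy_schwarz_weights:
  fixes a l k e n :: real
  assumes "(a + 1) * l + k + e = n"
  shows "n\<^sup>2 / (a\<^sup>2 + 2 * a + 3) \<le> e\<^sup>2 + l\<^sup>2 + k\<^sup>2"
proof -
  have D: "a\<^sup>2 + 2 * a + 3 > 0"
    using zero_le_power2[of "a + 1"] by (simp add: power2_eq_square algebra_simps)
  \<comment> \<open>Lagrange's identity for the vectors \<open>(a + 1, 1, 1)\<close> and
    \<open>(l, k, e)\<close>.\<close>
  have "(a\<^sup>2 + 2 * a + 3) * (e\<^sup>2 + l\<^sup>2 + k\<^sup>2) - n\<^sup>2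
      = ((a + 1) * k - l)\<^sup>2 + ((a + 1) * e - l)\<^sup>2 + (k - e)\<^sup>2"
    unfolding assms[symmetric] by (simp add: power2_eq_square algebra_simps)
  also have "\<dots> \<ge> 0" by simp
  finally show ?thesis
    using D by (simp add: divide_le_eq mult.commute)
qed

text \<open>The second summand is the price of passing from the multiple \<open>a * (n div a)\<close> to a general \<open>n\<close>.\<close>

definition target :: "real \<Rightarrow> real \<Rightarrow> real" where
  "target a n = n\<^sup>2 / (a\<^sup>2 + 2 * a + 3) + 2 * a * n / (a\<^sup>2 + 2 * a + 3)"

text \<open>In the next two lemmas \<open>\<mu>\<close> and \<open>\<nu>\<close> are the numbers of reds in \<open>{1..M}\<close> and \<open>{M<..n}\<close>, and \<open>k\<close> is
  \<open>a\<close> times the number of elements of \<open>{1..M}\<close> in the colour that is rarer there (blue in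
  \<open>rare_blue_bound\<close>, red in \<open>rare_red_bound\<close>). The free parameters \<open>l\<close> and \<open>q\<close> are truncations of \<open>\<mu>\<close>
  and \<open>\<nu>\<close>; near the extremal colouring \<open>l = \<mu>\<close> and \<open>q = \<nu>\<close>.\<close>

lemma rare_blue_bound:
  fixes a n k r \<mu> \<nu> M X :: real
  assumes a: "a = 2 \<or> a \<ge> 3" and n: "n > 0" "n = a * M" and k: "0 \<le> k" "2 * k \<le> n"
    and r: "2 * r \<le> n" "r = \<mu> + \<nu>" "\<nu> \<ge> 0" and \<mu>: "n - k = a * \<mu>"
    and I: "\<And>l q. 0 \<le> l \<Longrightarrow> 0 \<le> q \<Longrightarrow> 2 * l \<le> n - r \<Longrightarrow> 2 * q \<le> n - r \<Longrightarrow> l \<le> \<mu> \<Longrightarrow> q \<le> \<nu> \<Longrightarrow> q \<le> M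
      \<Longrightarrow> l + q \<le> k \<Longrightarrow> X \<ge> (k - r)\<^sup>2 + l\<^sup>2 + q\<^sup>2 + a * (n - r - k + l + q)"
    and II: "\<And>l. 0 \<le> l \<Longrightarrow> 2 * l \<le> n - r \<Longrightarrow> l \<le> \<mu>
      \<Longrightarrow> X \<ge> (k - r)\<^sup>2 + 2 * l * k - k\<^sup>2 + a * (n - r)"
  shows "target a n \<le> X"
proof -
  define D where "D = a\<^sup>2 + 2 * a + 3"
  have a2: "a \<ge> 2" using a by auto
  have D11: "D \<ge> 11"
    using mult_mono[of 2 a 2 a] a2 by (simp add: D_def power2_eq_square)
  have D18: "D \<ge> 18" if "a \<ge> 3"
    using mult_mono[of 3 a 3 a] that by (simp add: D_def power2_eq_square)
  have D4: "4 * a \<le> D"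
    using zero_le_power2[of "a - 1"] by (simp add: D_def power2_eq_square algebra_simps)
  have D1: "(a + 1)\<^sup>2 \<le> D" "a\<^sup>2 \<le> D"
    using a2 by (simp_all add: D_def power2_eq_square algebra_simps)
  have tgt: "target a n = n\<^sup>2 / D + 2 * a * n / D"
    by (simp add: target_def D_def)
  \<comment> \<open>The second summand of \<open>target\<close> is paid for by the linear terms of
    \<open>I\<close> and \<open>II\<close>, which turn out to be at least
    \<open>n / 2\<close>.\<close>
  have slack: "2 * a * n / D \<le> n / 2"
  proof -
    have "4 * a * n \<le> D * n" using D4 n by (intro mult_right_mono) auto
    then show ?thesis using D11 by (simp add: field_simps)
  qed
  have \<mu>n: "n \<le> 2 * (a * \<mu>)" using k \<mu> by linarith
  have \<mu>0: "\<mu> > 0" using \<mu>n n a2 by (simp add: zero_less_mult_iff)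
  have anr: "n / 2 \<le> a * (n - r)"
  proof -
    have "2 * (n - r) \<le> a * (n - r)" using a2 r n by (intro mult_right_mono) auto
    moreover have "n / 2 \<le> 2 * (n - r)" using r(1) n(1) by simp
    ultimately show ?thesis by (rule order.trans[rotated])
  qed
  \<comment> \<open>A single square is enough once its root is a large enough fraction of
    \<open>n\<close>.\<close>
  have sq: "n\<^sup>2 / D \<le> x\<^sup>2" if "n \<le> c * x" "c\<^sup>2 \<le> D" for c x :: real
  proof -
    have "n\<^sup>2 \<le> (c * x)\<^sup>2" using that n by (intro power_mono) auto
    also have "\<dots> \<le> D * x\<^sup>2" using that by (simp add: power_mult_distrib mult_right_mono)
    finally show ?thesis using D11 by (simp add: field_simps)
  qed
  have bonus: "a * l \<le> a * (n - r - k + l + q)" if "q \<ge> 0" for l q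
    using that a2 r k by (intro mult_left_mono) auto
  show ?thesis
  \<comment> \<open>In the first case \<open>l = \<mu>\<close> meets the constraint
    \<open>2 * l \<le> n - r\<close>; otherwise \<open>l\<close> is cut off at
    \<open>(n - r) / 2\<close>.\<close>
  proof (cases "2 * \<mu> \<le> n - r")
    case True
    show ?thesis
    proof (cases "k < \<mu>")
      case True
      \<comment> \<open>For \<open>k < \<mu>\<close> the constraint \<open>l + q \<le> k\<close> of
        \<open>I\<close> rules out \<open>l = \<mu>\<close>, so \<open>II\<close> takes
        over.\<close>
      have "X \<ge> (k - r)\<^sup>2 + 2 * \<mu> * k - k\<^sup>2 + a * (n - r)"
        using II[of \<mu>] \<mu>0 \<open>2 * \<mu> \<le> n - r\<close> by simp
      moreover have "(r - k)\<^sup>2 \<ge> (\<mu> - k)\<^sup>2"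
        using r True by (intro power_mono) auto
      then have "(k - r)\<^sup>2 + 2 * \<mu> * k - k\<^sup>2 \<ge> \<mu>\<^sup>2"
        by (simp add: power2_eq_square algebra_simps)
      moreover have "n \<le> (a + 1) * \<mu>" using \<mu> True by (simp add: algebra_simps)
      then have "n\<^sup>2 / D \<le> \<mu>\<^sup>2" using D1 by (intro sq[of "a + 1"])
      ultimately show ?thesis using slack anr by (simp add: tgt)
    next
      case False
      \<comment> \<open>The largest \<open>q\<close> that \<open>I\<close> admits together with
        \<open>l = \<mu>\<close>; the cases below follow the constraint that binds.\<close>
      define q where "q = min (min \<nu> (k - \<mu>)) (min ((n - r) / 2) M)"
      have M0: "M > 0" using n a2 by (simp add: zero_less_mult_iff)
      have q0: "q \<ge> 0" using False r n M0 by (auto simp: q_def)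
      have X: "X \<ge> (k - r)\<^sup>2 + \<mu>\<^sup>2 + q\<^sup>2 + a * (n - r - k + \<mu> + q)"
      proof (intro I)
        show "2 * q \<le> n - r" "q \<le> \<nu>" "q \<le> M" "\<mu> + q \<le> k"
          by (auto simp: q_def min_def field_simps)
      qed (use \<mu>0 q0 True in auto)
      have "n\<^sup>2 / D \<le> (k - r)\<^sup>2 + \<mu>\<^sup>2 + q\<^sup>2"
      proof -
        consider "q = \<nu>" | "q = k - \<mu>" | "q = (n - r) / 2" | "q = M"
          unfolding q_def by (metis min_def)
        then show ?thesis
        proof cases
          \<comment> \<open>The critical case:
            \<open>(a + 1) * \<mu> + \<nu> + (k - r) = a * \<mu> + k = n\<close>.\<close>
          case 1
          then show ?thesis
            using cauchy_schwarz_weights[of a \<mu> q "k - r" n] r \<mu> by (simp add: D_def algebra_simps)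
        next
          \<comment> \<open>Here \<open>(a + 1) * \<mu> + q = n\<close> already, so the square of
            \<open>k - r\<close> is dropped.\<close>
          case 2
          then have "n\<^sup>2 / D \<le> 0\<^sup>2 + \<mu>\<^sup>2 + q\<^sup>2"
            using cauchy_schwarz_weights[of a \<mu> q 0 n] \<mu> by (simp add: D_def algebra_simps)
          then show ?thesis by (smt (verit) zero_le_power2 zero_power2)
        next
          case 3
          then have q4: "n \<le> 4 * q" using r by simp
          show ?thesis
          \<comment> \<open>One square of size \<open>n\<^sup>2 / 16\<close> suffices for
            \<open>D \<ge> 18\<close>; for \<open>a = 2\<close>, where \<open>D \<ge> 11\<close>,
            both \<open>\<mu>\<close> and \<open>q\<close> are at least
            \<open>n / 4\<close>.\<close>
          proof (cases "a \<ge> 3")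
            case True
            have "n\<^sup>2 / D \<le> q\<^sup>2" by (rule sq[OF q4]) (use D18 True in simp)
            then show ?thesis by (smt (verit) zero_le_power2)
          next
            case False
            then have "a = 2" using a by simp
            then have "n \<le> 4 * \<mu>" using \<mu>n by simp
            then have "n\<^sup>2 \<le> 16 * \<mu>\<^sup>2"
              using n power_mono[of n "4 * \<mu>" 2] by (simp add: power_mult_distrib)
            moreover have "n\<^sup>2 \<le> 16 * q\<^sup>2"
              using q4 n power_mono[of n "4 * q" 2] by (simp add: power_mult_distrib)
            moreover have "n\<^sup>2 / D \<le> n\<^sup>2 / 11" using D11 by (intro divide_left_mono) auto
            ultimately show ?thesis
              using zero_le_power2[of "k - r"] zero_le_power2[of n] by linarith
          qed
        next
          case 4
          then have "n\<^sup>2 / D \<le> q\<^sup>2" using n D1 by (intro sq[of a]) auto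
          then show ?thesis by (smt (verit) zero_le_power2)
        qed
      qed
      then show ?thesis using X slack bonus[of q \<mu>] q0 \<mu>n by (simp add: tgt)
    qed
  next
    case False
    define l where "l = (n - r) / 2"
    have l: "l < \<mu>" "4 * l \<ge> n" "l > 0" using False r(1) n(1) by (auto simp: l_def)
    have IIl: "X \<ge> (k - r)\<^sup>2 + 2 * l * k - k\<^sup>2 + a * (n - r)"
      using II[of l] l by (simp add: l_def)
    have IIe: "(k - r)\<^sup>2 + 2 * l * k - k\<^sup>2 = r\<^sup>2 + k * (n - 3 * r)"
      by (simp add: l_def power2_eq_square field_simps)
    show ?thesis
    proof (cases "a = 2")
      case True
      have k2: "k = n - 2 * \<mu>" using \<mu> True by simp
      have "D = 11" using True by (simp add: D_def)
      show ?thesis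
      proof (cases "l \<le> k")
        case True
        \<comment> \<open>The choice \<open>q = k - l\<close> exhausts \<open>l + q \<le> k\<close>,
          and the weights still balance:
          \<open>3 * l + (k - l) + (r - k) = 2 * l + r = n\<close>.\<close>
        have X: "X \<ge> (k - r)\<^sup>2 + l\<^sup>2 + (k - l)\<^sup>2 + a * (n - r - k + l + (k - l))"
        proof (intro I)
          have "2 * l = n - r" "2 * M = n" using n \<open>a = 2\<close> by (auto simp: l_def)
          then show "0 \<le> l" "0 \<le> k - l" "2 * l \<le> n - r" "2 * (k - l) \<le> n - r" "l \<le> \<mu>"
            "k - l \<le> \<nu>" "k - l \<le> M" "l + (k - l) \<le> k"
            using l True r(1) r(2) k2 by (simp_all add: algebra_simps)
        qed
        have "n\<^sup>2 / D \<le> (r - k)\<^sup>2 + l\<^sup>2 + (k - l)\<^sup>2"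
          using cauchy_schwarz_weights[of a l "k - l" "r - k" n] \<open>a = 2\<close>
          by (simp add: D_def l_def field_simps)
        moreover have "n / 2 \<le> a * l" using l \<open>a = 2\<close> by simp
        ultimately show ?thesis
          using X slack bonus[of "k - l" l] True unfolding tgt power2_commute[of r k] by linarith
      next
        case False
        have k1: "2 * k \<le> n - r" using False by (simp add: l_def)
        have k0: "k \<ge> n - 2 * r" using k2 r by simp
        \<comment> \<open>The left side is linear in \<open>k\<close>, so the sign of
          \<open>n - 3 * r\<close> decides which end of
          \<open>n - 2 * r \<le> k \<le> (n - r) / 2\<close> is worst. The remaining quadratic in
          \<open>r\<close> is handled by completing the square.\<close>
        have "r\<^sup>2 + k * (n - 3 * r) \<ge> n\<^sup>2 / 11"
        proof (cases "3 * r \<le> n")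
          case True
          have "k * (n - 3 * r) \<ge> (n - 2 * r) * (n - 3 * r)"
            using k0 True by (intro mult_right_mono) auto
          moreover have "r\<^sup>2 + (n - 2 * r) * (n - 3 * r) - n\<^sup>2 / 11
              = (5 * n - 14 * r)\<^sup>2 / 28 + 5 / 308 * n\<^sup>2"
            by (simp add: power2_eq_square field_simps)
          ultimately show ?thesis
            using zero_le_power2[of n] zero_le_power2[of "5 * n - 14 * r"] by linarith
        next
          case False
          then have "(2 * k) * (n - 3 * r) \<ge> (n - r) * (n - 3 * r)"
            using k1 by (intro mult_right_mono_neg) auto
          moreover have "r\<^sup>2 + (n - r) * (n - 3 * r) / 2 - n\<^sup>2 / 11
              = (2 * n - 5 * r)\<^sup>2 / 10 + n\<^sup>2 / 110"
            by (simp add: power2_eq_square field_simps)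
          ultimately show ?thesis
            using zero_le_power2[of n] zero_le_power2[of "2 * n - 5 * r"] by linarith
        qed
        then show ?thesis using IIl IIe slack anr unfolding tgt \<open>D = 11\<close> by linarith
      qed
    next
      case False
      then have a3: "a \<ge> 3" using a by simp
      have "3 * \<mu> \<le> a * \<mu>" using a3 \<mu>0 by simp
      then have k1: "4 * k \<le> n" using \<mu> l by linarith
      have r4: "4 * r \<ge> n" using l r by linarith
      \<comment> \<open>Again linear in \<open>k\<close>, now on
        \<open>0 \<le> k \<le> n / 4\<close>; 18 is the value of \<open>D\<close> at
        \<open>a = 3\<close>.\<close>
      have "r\<^sup>2 + k * (n - 3 * r) \<ge> n\<^sup>2 / 18"
      proof (cases "3 * r \<le> n")
        case True
        then have "k * (n - 3 * r) \<ge> 0" using k by simp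
        moreover have "n\<^sup>2 \<le> 16 * r\<^sup>2"
          using r4 n power_mono[of n "4 * r" 2] by (simp add: power_mult_distrib)
        ultimately show ?thesis using zero_le_power2[of r] by linarith
      next
        case False
        then have "(4 * k) * (n - 3 * r) \<ge> n * (n - 3 * r)"
          using k1 by (intro mult_right_mono_neg) auto
        moreover have "r\<^sup>2 + n * (n - 3 * r) / 4 - n\<^sup>2 / 18
            = (3 * n - 8 * r)\<^sup>2 / 64 + 31 / 576 * n\<^sup>2"
          by (simp add: power2_eq_square field_simps)
        ultimately show ?thesis
          using zero_le_power2[of n] zero_le_power2[of "3 * n - 8 * r"] by linarith
      qed
      moreover have "n\<^sup>2 / D \<le> n\<^sup>2 / 18" using D18[OF a3] by (intro divide_left_mono) auto
      ultimately show ?thesis using IIl IIe slack anr unfolding tgt by linarith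
    qed
  qed
qed

lemma rare_red_bound:
  fixes a n k r \<mu> \<nu> M X :: real
  assumes a: "a = 2 \<or> a \<ge> 3" and n: "n \<ge> 4 * a" "n \<ge> 20" "n = a * M" and k: "0 \<le> k" "2 * k \<le> n"
    and r: "2 * r \<le> n" "r = \<mu> + \<nu>" "\<nu> \<ge> 0" and \<mu>: "k = a * \<mu>"
    and I: "\<And>l q. 0 \<le> l \<Longrightarrow> 0 \<le> q \<Longrightarrow> 2 * l \<le> n - r \<Longrightarrow> 2 * q \<le> n - r
      \<Longrightarrow> l \<le> \<mu> \<and> q \<le> \<nu> \<and> q \<le> M \<or> 2 * l \<le> r \<and> 2 * q \<le> r
      \<Longrightarrow> l + q \<le> k \<Longrightarrow> X \<ge> (n - k - r)\<^sup>2 + l\<^sup>2 + q\<^sup>2 + a * (k + r - l - q)"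
    and II: "\<And>l. 0 \<le> l \<Longrightarrow> 2 * l \<le> n - r \<Longrightarrow> 2 * l \<le> r
      \<Longrightarrow> X \<ge> (n - k - r)\<^sup>2 + 2 * l * k - k\<^sup>2 + a * r"
  shows "target a n \<le> X"
proof -
  have a2: "a \<ge> 2" using a by auto
  have \<mu>0: "\<mu> \<ge> 0" using k \<mu> a2 by (simp add: zero_le_mult_iff)
  have r0: "r \<ge> 0" using r \<mu>0 by simp
  show ?thesis
  proof (cases "a = 2")
    case True
    have tgt: "target a n = n\<^sup>2 / 11 + 4 * n / 11" using True by (simp add: target_def)
    have nn: "20 * n \<le> n\<^sup>2"
      unfolding power2_eq_square using n(2) by (intro mult_right_mono) auto
    have cs: "n\<^sup>2 / 11 \<le> e\<^sup>2 + l\<^sup>2 + q\<^sup>2" if "3 * l + q + e = n" for l q e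
      using cauchy_schwarz_weights[of 2 l q e n] that by simp
    \<comment> \<open>Below the threshold \<open>2 * n / 11\<close> the linear terms
      \<open>2 * k\<close> or \<open>2 * r\<close> may not cover \<open>4 * n / 11\<close>, but then
      this square alone is ample.\<close>
    have far: "(n - k - r)\<^sup>2 \<ge> n\<^sup>2 * 49 / 121" if "11 * k \<le> 2 * n" "11 * r \<le> 2 * n"
    proof -
      have "(11 * (n - k - r))\<^sup>2 \<ge> (7 * n)\<^sup>2" using that n(2) by (intro power_mono) auto
      then show ?thesis unfolding power_mult_distrib by simp
    qed
    \<comment> \<open>The constraint \<open>l + q \<le> k\<close> separates the cases: it admits
      \<open>l = \<mu>\<close>, \<open>q = \<nu>\<close> in the first and \<open>l = r / 2\<close>,
      \<open>q = k - r / 2\<close> in the second; in the third \<open>r / 2\<close> exceeds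
      \<open>k\<close> and \<open>II\<close> is used.\<close>
    consider "r \<le> k" | "k \<le> r" "r \<le> 2 * k" | "2 * k < r" by linarith
    then show ?thesis
    proof cases
      case 1
      have X: "X \<ge> (n - k - r)\<^sup>2 + \<mu>\<^sup>2 + \<nu>\<^sup>2 + a * (k + r - \<mu> - \<nu>)"
        using \<mu>0 1 r \<mu> True k n by (intro I) auto
      show ?thesis
      proof (cases "11 * k \<le> 2 * n")
        case True
        then have "(n - k - r)\<^sup>2 \<ge> n\<^sup>2 * 49 / 121" using 1 by (intro far) auto
        moreover have "a * (k + r - \<mu> - \<nu>) = 2 * k" using \<open>a = 2\<close> r by simp
        ultimately show ?thesis
          using X nn k(1) n(2) zero_le_power2[of \<mu>] zero_le_power2[of \<nu>] unfolding tgt by linarith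
      next
        case False
        then show ?thesis using X cs[of \<mu> \<nu> "n - k - r"] \<open>a = 2\<close> r \<mu> unfolding tgt by simp
      qed
    next
      case 2
      have X: "X \<ge> (n - k - r)\<^sup>2 + (r / 2)\<^sup>2 + (k - r / 2)\<^sup>2 + a * (k + r - r / 2 - (k - r / 2))"
        using 2 r(1) r0 by (intro I) (auto simp: field_simps)
      show ?thesis
      proof (cases "11 * r \<le> 2 * n")
        case True
        then have "(n - k - r)\<^sup>2 \<ge> n\<^sup>2 * 49 / 121" using 2 by (intro far) auto
        moreover have "a * (k + r - r / 2 - (k - r / 2)) = 2 * r" using \<open>a = 2\<close> by simp
        ultimately show ?thesis
          using X nn r0 n(2) zero_le_power2[of "r / 2"] zero_le_power2[of "k - r / 2"]
          unfolding tgt by linarith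
      next
        case False
        then show ?thesis using X cs[of "r / 2" "k - r / 2" "n - k - r"] \<open>a = 2\<close> unfolding tgt by simp
      qed
    next
      case 3
      have X: "X \<ge> (n - k - r)\<^sup>2 + 2 * (r / 2) * k - k\<^sup>2 + a * r"
        using 3 r r0 by (intro II) auto
      have "(n - k - r)\<^sup>2 + r * k - k\<^sup>2 \<ge> n\<^sup>2 / 8"
      proof -
        \<comment> \<open>Since \<open>k < r / 2 \<le> n / 4\<close>, the second factor is at least
          \<open>n / 4\<close>.\<close>
        have "(n / 2 - r) * (3 * n / 2 - 3 * k - r) \<ge> 0"
          using r 3 k n by (intro mult_nonneg_nonneg) auto
        moreover have "n * (n - 4 * k) / 8 \<ge> 0" using r(1) 3 n(2) by simp
        moreover have "(n - k - r)\<^sup>2 + r * k - k\<^sup>2 - n\<^sup>2 / 8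
            = (n / 2 - r) * (3 * n / 2 - 3 * k - r) + n * (n - 4 * k) / 8"
          by (simp add: power2_eq_square field_simps)
        ultimately show ?thesis by linarith
      qed
      then show ?thesis using X nn r0 True n(2) unfolding tgt by simp
    qed
  next
    case False
    then have a3: "a \<ge> 3" using a by simp
    define D where "D = a\<^sup>2 + 2 * a + 3"
    have D18: "D \<ge> 18" using mult_mono[of 3 a 3 a] a3 by (simp add: D_def power2_eq_square)
    \<comment> \<open>For \<open>a \<ge> 3\<close> a cruder bound suffices: the target is at most
      \<open>n\<^sup>2 / 12\<close>, the minimum of
      \<open>(n / 2 - 2 * l)\<^sup>2 + 2 * l\<^sup>2\<close>, attained at
      \<open>l = n / 6\<close>.\<close>
    have "target a n = (n\<^sup>2 + 2 * a * n) / D" by (simp add: target_def D_def add_divide_distrib)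
    also have "\<dots> \<le> (n\<^sup>2 + 2 * a * n) / 18"
      using D18 a3 n by (intro divide_left_mono add_nonneg_nonneg) auto
    also have "\<dots> \<le> n\<^sup>2 / 12"
    proof -
      have "4 * a * n \<le> n * n" using n by (intro mult_right_mono) auto
      then show ?thesis by (simp add: power2_eq_square)
    qed
    also have "\<dots> \<le> X"
    proof -
      define l where "l = min k r / 2"
      have "X \<ge> (n - k - r)\<^sup>2 + l\<^sup>2 + l\<^sup>2 + a * (k + r - l - l)"
        using k r r0 by (intro I) (auto simp: l_def min_def)
      moreover have "a * (k + r - l - l) \<ge> 0" using a3 k r0 by (intro mult_nonneg_nonneg) (auto simp: l_def)
      moreover have "(n - k - r)\<^sup>2 \<ge> (n / 2 - 2 * l)\<^sup>2"
        using k r by (intro power_mono) (auto simp: l_def min_def)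
      moreover have "(n / 2 - 2 * l)\<^sup>2 + l\<^sup>2 + l\<^sup>2 \<ge> n\<^sup>2 / 12"
        using zero_le_power2[of "n - 6 * l"] by (simp add: power2_eq_square algebra_simps)
      ultimately show ?thesis by linarith
    qed
    finally show ?thesis .
  qed
qed

subsection \<open>The drift and its envelope\<close>

definition prefix_sum :: "(nat \<Rightarrow> real) \<Rightarrow> nat \<Rightarrow> real" where
  "prefix_sum s t = (\<Sum>i=1..t. s i)"

text \<open>Written with prefix sums, the window sum extends past \<open>t = n / 2\<close>, where it
  becomes the negated sum over the reflected window.\<close>

definition drift :: "(nat \<Rightarrow> real) \<Rightarrow> nat \<Rightarrow> nat \<Rightarrow> real" where
  "drift s n t = prefix_sum s (n - t) - prefix_sum s t"

text \<open>Red means sign 1, which need not be the colour \<open>Red\<close>: the signs are chosen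
  later so that it is not the majority.\<close>

definition reds :: "(nat \<Rightarrow> real) \<Rightarrow> nat set \<Rightarrow> real" where
  "reds s A = real (card {i \<in> A. s i = 1})"

lemma drift_reflect: "t \<le> n \<Longrightarrow> drift s n (n - t) = - drift s n t"
  by (simp add: drift_def)

lemma drift_0: "drift s n 0 = prefix_sum s n"
  by (simp add: drift_def prefix_sum_def)

lemma drift_eq_sum:
  assumes "2 * t \<le> n"
  shows "drift s n t = sum s {t<..n - t}"
proof -
  have "{1..n - t} = {1..t} \<union> {t<..n - t}" using assms by auto
  then have "prefix_sum s (n - t) = prefix_sum s t + sum s {t<..n - t}"
    unfolding prefix_sum_def by (simp only:) (rule sum.union_disjoint, auto)
  then show ?thesis by (simp add: drift_def)
qed

text \<open>Under \<open>y \<mapsto> M - y\<close> the sum over \<open>0..M\<close> cancels, leaving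
  minus the term at 0, which is the total sum of signs.\<close>

lemma sum_drift_multiples: "(\<Sum>y=1..M. drift s (a * M) (a * y)) = - prefix_sum s (a * M)"
proof -
  have "drift s (a * M) (a * (M - y)) = - drift s (a * M) (a * y)" if "y \<le> M" for y
    using drift_reflect[of "a * y" "a * M" s] that by (simp add: diff_mult_distrib2)
  then have "(\<Sum>y\<le>M. drift s (a * M) (a * (M - y))) = - (\<Sum>y\<le>M. drift s (a * M) (a * y))"
    by (simp flip: sum_negf)
  moreover have "(\<Sum>y\<le>M. drift s (a * M) (a * (M - y))) = (\<Sum>y\<le>M. drift s (a * M) (a * y))"
    by (rule sum.reindex_bij_witness[of _ "\<lambda>y. M - y" "\<lambda>y. M - y"]) auto
  moreover have "(\<Sum>y\<le>M. drift s (a * M) (a * y)) = drift s (a * M) 0 + (\<Sum>y=1..M. drift s (a * M) (a * y))"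
    by (simp add: atMost_atLeast0 sum.atLeast_Suc_atMost)
  ultimately show ?thesis by (simp add: drift_0)
qed

lemma reds_mono: "finite B \<Longrightarrow> A \<subseteq> B \<Longrightarrow> reds s A \<le> reds s B"
  unfolding reds_def by (intro of_nat_mono card_mono) auto

lemma reds_le_card: "finite A \<Longrightarrow> reds s A \<le> card A"
  unfolding reds_def by (intro of_nat_mono card_mono) auto

lemma reds_nonneg: "reds s A \<ge> 0"
  by (simp add: reds_def)

lemma reds_union: "reds s (A \<union> B) \<le> reds s A + reds s B"
proof -
  have "{i \<in> A \<union> B. s i = 1} = {i \<in> A. s i = 1} \<union> {i \<in> B. s i = 1}" by auto
  then show ?thesis
    unfolding reds_def of_nat_add[symmetric] by (simp only: of_nat_le_iff card_Un_le)
qed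

lemma reds_union_disjoint:
  assumes "finite A" "finite B" "A \<inter> B = {}"
  shows "reds s (A \<union> B) = reds s A + reds s B"
proof -
  have "{i \<in> A \<union> B. s i = 1} = {i \<in> A. s i = 1} \<union> {i \<in> B. s i = 1}" by auto
  moreover have "card \<dots> = card {i \<in> A. s i = 1} + card {i \<in> B. s i = 1}"
    using assms by (intro card_Un_disjoint) auto
  ultimately show ?thesis unfolding reds_def by simp
qed

lemma sum_eq_reds:
  assumes "finite A" and s: "\<And>i. s i = 1 \<or> s i = -1"
  shows "sum s A = 2 * reds s A - card A"
proof -
  have "s i = 2 * of_bool (s i = 1) - 1" for i
    using s[of i] by auto
  then have "sum s A = (\<Sum>i\<in>A. 2 * of_bool (s i = 1) - 1)"
    by (rule sum.cong[OF refl])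
  then show ?thesis
    using assms(1) by (simp add: reds_def card_filter_eq_sum sum_subtractf sum_distrib_left)
qed

text \<open>Three counts of reds. Outside the window lie \<open>t\<close> numbers at either end; the
  left end and the window cover \<open>{1..M}\<close>, and for \<open>t \<le> M\<close> the window
  and the right end cover \<open>{M<..n}\<close>.\<close>

lemma reds_window_lower_bound:
  assumes t: "2 * t \<le> n" and M: "2 * M \<le> n" "reds s {1..n} = \<mu> + \<nu>" "\<mu> = reds s {1..M}"
    and lq: "l \<le> \<mu> \<and> q \<le> \<nu> \<and> q \<le> real M \<or> 2 * l \<le> \<mu> + \<nu> \<and> 2 * q \<le> \<mu> + \<nu>"
  shows "max 0 (l - t) + max 0 (q - t) \<le> reds s {t<..n - t}"
proof -
  have all: "\<mu> + \<nu> \<le> reds s {t<..n - t} + 2 * real t"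
  proof -
    have "{1..n} = ({1..t} \<union> {n - t<..n}) \<union> {t<..n - t}" using t by auto
    then have "reds s {1..n} \<le> reds s ({1..t} \<union> {n - t<..n}) + reds s {t<..n - t}"
      by (simp only: reds_union)
    moreover have "reds s ({1..t} \<union> {n - t<..n}) \<le> reds s {1..t} + reds s {n - t<..n}"
      by (rule reds_union)
    moreover have "reds s {1..t} \<le> t" using reds_le_card[of "{1..t}" s] by simp
    moreover have "reds s {n - t<..n} \<le> t" using reds_le_card[of "{n - t<..n}" s] t by simp
    ultimately show ?thesis using M by simp
  qed
  have left: "\<mu> \<le> reds s {t<..n - t} + real t"
  proof -
    have "{1..M} \<subseteq> {1..t} \<union> {t<..n - t}" using t M by auto
    then have "\<mu> \<le> reds s ({1..t} \<union> {t<..n - t})" unfolding M by (intro reds_mono) auto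
    also have "\<dots> \<le> reds s {1..t} + reds s {t<..n - t}" by (rule reds_union)
    finally show ?thesis using reds_le_card[of "{1..t}" s] by simp
  qed
  have right: "\<nu> \<le> reds s {t<..n - t} + real t" if "t \<le> M"
  proof -
    have "{1..n} = {1..M} \<union> {M<..n}" using M by auto
    then have "reds s {1..n} = reds s {1..M} + reds s {M<..n}"
      by (simp only:) (intro reds_union_disjoint; auto)
    then have "\<nu> = reds s {M<..n}" using M by simp
    also have "\<dots> \<le> reds s ({t<..n - t} \<union> {n - t<..n})" using t that by (intro reds_mono) auto
    also have "\<dots> \<le> reds s {t<..n - t} + reds s {n - t<..n}" by (rule reds_union)
    finally show ?thesis using reds_le_card[of "{n - t<..n}" s] t by simp
  qed
  have \<mu>M: "\<mu> \<le> real M" using reds_le_card[of "{1..M}" s] M by simp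
  have pos: "reds s {t<..n - t} \<ge> 0"
    by (rule reds_nonneg)
  from lq show ?thesis
  proof (elim disjE conjE)
    assume "l \<le> \<mu>" "q \<le> \<nu>" "q \<le> real M"
    then show ?thesis
      using all left right \<mu>M pos
      by (cases "l \<le> t"; cases "q \<le> t"; cases "t \<le> M") simp_all
  next
    assume "2 * l \<le> \<mu> + \<nu>" "2 * q \<le> \<mu> + \<nu>"
    then show ?thesis
      using all pos by (cases "l \<le> t"; cases "q \<le> t") simp_all
  qed
qed

definition envelope :: "real \<Rightarrow> real \<Rightarrow> real \<Rightarrow> real \<Rightarrow> real" where
  "envelope n l q t = n - 2 * t - 2 * max 0 (l - t) - 2 * max 0 (q - t)"

text \<open>With \<open>\<rho>\<close> the number of reds in the window, the lower bound on
  \<open>\<rho>\<close> controls \<open>- d\<close>. For \<open>d\<close> the blues are counted: of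
  the \<open>n - r\<close> blues at most \<open>2 * t\<close> lie outside the window.\<close>

lemma abs_le_envelope:
  assumes "d = 2 * \<rho> - (n - 2 * t)" "\<rho> \<le> n - 2 * t" "\<rho> \<le> r"
    "max 0 (l - t) + max 0 (q - t) \<le> \<rho>" "2 * l \<le> n - r" "2 * q \<le> n - r"
  shows "\<bar>d\<bar> \<le> envelope n l q t"
proof -
  have "- d \<le> envelope n l q t"
    using assms(1,4) by (simp add: envelope_def)
  moreover have "d \<le> envelope n l q t"
    by (cases "l \<le> t"; cases "q \<le> t") (use assms in \<open>simp_all add: envelope_def\<close>)
  ultimately show ?thesis by linarith
qed

lemma abs_drift_le_envelope:
  assumes s: "\<And>i. s i = 1 \<or> s i = -1" and t: "2 * t \<le> n" and M: "2 * M \<le> n"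
    and lq: "2 * l \<le> n - reds s {1..n}" "2 * q \<le> n - reds s {1..n}"
      "l \<le> reds s {1..M} \<and> q \<le> reds s {1..n} - reds s {1..M} \<and> q \<le> real M
        \<or> 2 * l \<le> reds s {1..n} \<and> 2 * q \<le> reds s {1..n}"
  shows "\<bar>drift s n t\<bar> \<le> envelope n l q t"
proof -
  have "drift s n t = 2 * reds s {t<..n - t} - (real n - 2 * t)"
    using sum_eq_reds[of "{t<..n - t}" s] s t by (simp add: drift_eq_sum of_nat_diff)
  moreover have "reds s {t<..n - t} \<le> real n - 2 * t"
    using reds_le_card[of "{t<..n - t}" s] t by (simp add: of_nat_diff)
  moreover have "reds s {t<..n - t} \<le> reds s {1..n}"
    by (intro reds_mono) auto
  moreover have "max 0 (l - t) + max 0 (q - t) \<le> reds s {t<..n - t}"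
    using lq by (intro reds_window_lower_bound[of t n M s "reds s {1..M}" "reds s {1..n} - reds s {1..M}"] t M) auto
  ultimately show ?thesis
    using lq(1,2)
    by (intro abs_le_envelope[where \<rho> = "reds s {t<..n - t}" and r = "reds s {1..n}"]) simp_all
qed

text \<open>Subtract the threshold \<open>\<theta>\<close> from every term. Terms of
  \<open>f\<close> up to \<open>\<theta>\<close> only lower the sum, the others are charged
  injectively to \<open>J\<close>, and uncharged elements of \<open>J\<close> contribute
  nonnegatively; equal cardinalities restore \<open>\<theta>\<close>.\<close>

lemma sum_le_sum_of_largest:
  fixes f w :: "nat \<Rightarrow> real" and \<theta> :: real
  assumes fin: "finite B" "finite J" and card: "card J = card B"
    and inj: "inj_on g {y \<in> B. f y > \<theta>}"
    and fw: "\<And>y. y \<in> B \<Longrightarrow> f y > \<theta> \<Longrightarrow> f y \<le> w (g y) \<and> (w (g y) \<le> \<theta> \<or> g y \<in> J)"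
    and J: "\<And>i. i \<in> J \<Longrightarrow> w i \<ge> \<theta>"
  shows "sum f B \<le> sum w J"
proof -
  let ?B = "{y \<in> B. f y > \<theta>}"
  have "(\<Sum>y\<in>B. f y - \<theta>) \<le> (\<Sum>y\<in>?B. f y - \<theta>)"
  proof -
    have "(\<Sum>y\<in>B - ?B. f y - \<theta>) \<le> 0"
      by (intro sum_nonpos) auto
    then show ?thesis
      using sum.subset_diff[of ?B B "\<lambda>y. f y - \<theta>"] fin by auto
  qed
  also have "\<dots> \<le> (\<Sum>y\<in>?B. w (g y) - \<theta>)"
    using fw by (intro sum_mono) auto
  also have "\<dots> = (\<Sum>i\<in>g ` ?B. w i - \<theta>)"
    by (simp add: sum.reindex[OF inj])
  also have "\<dots> \<le> (\<Sum>i\<in>J. w i - \<theta>)"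
    using fin fw J by (intro sum_mono2) force+
  finally show ?thesis
    using card by (simp add: sum_subtractf)
qed

text \<open>For \<open>x \<ge> a\<close> the term \<open>2 * a * x\<close> is exactly the decrease
  of \<open>x * (x + a)\<close> when \<open>x\<close> drops by \<open>a\<close>; near zero,
  truncation leaves an inequality.\<close>

lemma telescoping_lower_bound:
  fixes a l :: real
  assumes "a > 0" "l \<ge> 0" "l \<le> a * K"
  shows "l\<^sup>2 + a * l \<le> (\<Sum>i<K. 2 * a * max 0 (l - a * real i))"
proof -
  define \<phi> where "\<phi> x = max 0 x * (max 0 x + a)" for x
  have step: "\<phi> x - \<phi> (x - a) \<le> 2 * a * max 0 x" for x
  proof -
    consider "x \<le> 0" | "0 \<le> x" "x \<le> a" | "a \<le> x" by linarith
    then show ?thesis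
    proof cases
      case 2
      have "x * x \<le> a * x" using 2 by (intro mult_right_mono) auto
      then show ?thesis using 2 by (simp add: \<phi>_def max_def algebra_simps)
    qed (use \<open>a > 0\<close> in \<open>auto simp: \<phi>_def max_def algebra_simps\<close>)
  qed
  have "\<phi> l - \<phi> (l - a * real K) \<le> (\<Sum>i<K. 2 * a * max 0 (l - a * real i))"
  proof (induction K)
    case (Suc K)
    then show ?case using step[of "l - a * real K"] by (simp add: algebra_simps)
  qed simp
  moreover have "\<phi> l = l\<^sup>2 + a * l" "\<phi> (l - a * real K) = 0"
    using assms by (simp_all add: \<phi>_def power2_eq_square algebra_simps)
  ultimately show ?thesis by simp
qed

lemma sum_envelope_le:
  assumes "a > 0" "l \<ge> 0" "q \<ge> 0" "l + q \<le> a * real K"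
  shows "a * (\<Sum>i<K. envelope n l q (a * real i))
    \<le> n * (a * K) - (a * K)\<^sup>2 + a * (a * K) - (l\<^sup>2 + a * l) - (q\<^sup>2 + a * q)"
proof -
  have "2 * (\<Sum>i<K. real i) = real K * (real K - 1)"
    by (induction K) (auto simp: algebra_simps)
  then have lin: "2 * a * a * (\<Sum>i<K. real i) = a * (a * (real K * (real K - 1)))"
    by simp
  have "a * (\<Sum>i<K. envelope n l q (a * real i))
    = (\<Sum>i<K. a * n - 2 * a * a * real i - 2 * a * max 0 (l - a * real i) - 2 * a * max 0 (q - a * real i))"
    unfolding sum_distrib_left by (intro sum.cong refl) (simp add: envelope_def algebra_simps)
  also have "\<dots> = n * (a * K) - 2 * a * a * (\<Sum>i<K. real i)
      - (\<Sum>i<K. 2 * a * max 0 (l - a * real i)) - (\<Sum>i<K. 2 * a * max 0 (q - a * real i))"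
    by (simp add: sum_subtractf sum_distrib_left)
  also have "\<dots> \<le> n * (a * K) - 2 * a * a * (\<Sum>i<K. real i) - (l\<^sup>2 + a * l) - (q\<^sup>2 + a * q)"
    using assms by (intro diff_mono order.refl telescoping_lower_bound) auto
  finally show ?thesis
    unfolding lin by (simp add: power2_eq_square algebra_simps)
qed

text \<open>The value \<open>n - 2 * k\<close> serves as the threshold: the envelope is above it up
  to \<open>t = k\<close> and, by \<open>envelope_le\<close>, below it from there on.\<close>

lemma envelope_ge:
  assumes "0 \<le> t" "t \<le> k" "l + q \<le> k" "0 \<le> l" "0 \<le> q"
  shows "envelope n l q t \<ge> n - 2 * k"
  using assms by (auto simp: envelope_def max_def)

lemma envelope_le: "envelope n l q t \<le> n - 2 * t"
  by (simp add: envelope_def)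

subsection \<open>Bounding the number of non-monochromatic triples\<close>

text \<open>For fixed \<open>y\<close> the signs of all \<open>x\<close> and all \<open>z\<close>
  add up to \<open>S\<close> plus the drift at \<open>a * y\<close>, which handles the pairs
  containing \<open>y\<close>; the pairs \<open>(x, z)\<close> are left to the autocorrelation
  bound.\<close>

lemma non_monochromatic_count_le:
  fixes \<chi> :: "nat \<Rightarrow> color" and s :: "nat \<Rightarrow> real"
  assumes "a > 0" and s: "\<And>i. s i = 1 \<or> s i = -1"
    and s_eq: "\<And>i j. \<chi> i = \<chi> j \<longleftrightarrow> s i = s j"
    and n: "n = real (a * M)" and r: "r = reds s {1..a * M}" and m: "m = a * reds s {1..M}"
  shows "a * (2 * real (card (non_monochromatic_triples a (a * M) \<chi>)))
    \<le> n\<^sup>2 - a * n / 2 - ((n - r - m)\<^sup>2 + m * (n - m) + a / 2 * (\<Sum>y=1..M. s y * drift s (a * M) (a * y)))"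
proof -
  define C where "C = (\<Sum>y=1..M. \<Sum>x=1..a * M - a * y. s x * s (x + a * y))"
  define Z where "Z = (\<Sum>y=1..M. s y * drift s (a * M) (a * y))"
  define S where "S = prefix_sum s (a * M)"
  define \<sigma> where "\<sigma> = (\<Sum>y=1..M. s y)"
  have shift: "(\<Sum>x=1..a * M - a * y. s (x + a * y)) = S - prefix_sum s (a * y)" if "y \<le> M" for y
  proof -
    have "{1..N} = {1..t} \<union> {t<..N}" if "t \<le> N" for t N :: nat using that by auto
    from this[OF mult_le_mono2[OF that, of a]]
    have "{1..a * M} = {1..a * y} \<union> {a * y<..a * M}" .
    then have "S = prefix_sum s (a * y) + (\<Sum>x\<in>{a * y<..a * M}. s x)"
      unfolding S_def prefix_sum_def by (simp only:) (rule sum.union_disjoint, auto)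
    moreover have "(\<Sum>x=1..a * M - a * y. s (x + a * y)) = (\<Sum>x\<in>{a * y<..a * M}. s x)"
      by (rule sum.reindex_bij_witness[of _ "\<lambda>x. x - a * y" "\<lambda>x. x + a * y"]) auto
    ultimately show ?thesis by simp
  qed
  have "2 * real (card (non_monochromatic_triples a (a * M) \<chi>))
      = (\<Sum>y=1..M. 3 / 2 * (a * (real M - y)) - s y * S / 2 - s y * drift s (a * M) (a * y) / 2
          - (\<Sum>x=1..a * M - a * y. s x * s (x + a * y)) / 2)"
    unfolding card_non_monochromatic_triples_multiple[OF assms(1-3)]
  proof (intro sum.cong refl)
    fix y assume "y \<in> {1..M}"
    then have y: "y \<le> M" by simp
    have "(\<Sum>x=1..a * M - a * y. (3 - s x * s y - s y * s (x + a * y) - s x * s (x + a * y)) / 2)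
        = 3 / 2 * real (a * M - a * y) - s y * prefix_sum s (a * M - a * y) / 2
          - s y * (\<Sum>x=1..a * M - a * y. s (x + a * y)) / 2
          - (\<Sum>x=1..a * M - a * y. s x * s (x + a * y)) / 2"
      by (simp add: sum_subtractf sum_distrib_left prefix_sum_def mult.commute flip: sum_divide_distrib
          add: diff_divide_distrib)
    then show "(\<Sum>x=1..a * M - a * y. (3 - s x * s y - s y * s (x + a * y) - s x * s (x + a * y)) / 2)
        = 3 / 2 * (a * (real M - y)) - s y * S / 2 - s y * drift s (a * M) (a * y) / 2
          - (\<Sum>x=1..a * M - a * y. s x * s (x + a * y)) / 2"
      unfolding shift[OF y] drift_def using y by (simp add: of_nat_diff field_simps)
  qed
  also have "\<dots> = 3 / 2 * (a * (\<Sum>y=1..M. real M - y)) - \<sigma> * S / 2 - Z / 2 - C / 2"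
    unfolding \<sigma>_def Z_def C_def sum_distrib_left sum_distrib_right sum_divide_distrib sum_subtractf[symmetric]
    by (rule refl)
  also have "(\<Sum>y=1..M. real M - y) = real M * (real M - 1) / 2"
  proof -
    have "(\<Sum>y=1..M. real y) = real M * (real M + 1) / 2"
      by (induction M) (auto simp: field_simps)
    then show ?thesis by (simp add: sum_subtractf field_simps)
  qed
  finally have count: "2 * real (card (non_monochromatic_triples a (a * M) \<chi>))
    = 3 / 2 * (a * (real M * (real M - 1) / 2)) - \<sigma> * S / 2 - Z / 2 - C / 2" .
  have corr: "S\<^sup>2 \<le> a * (n + 2 * C)"
    using autocorrelation_lower_bound[OF assms(1,2), where M = M] by (simp add: S_def C_def prefix_sum_def n)
  have S: "S = 2 * r - n"
    unfolding S_def prefix_sum_def r n using sum_eq_reds[of "{1..a * M}" s] s by simp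
  have \<sigma>: "a * \<sigma> = 2 * m - n"
  proof -
    have \<sigma>_reds: "\<sigma> = 2 * reds s {1..M} - M"
      unfolding \<sigma>_def using sum_eq_reds[of "{1..M}" s] s by simp
    show ?thesis unfolding \<sigma>_reds m n by (simp add: algebra_simps)
  qed
  have "a * (2 * real (card (non_monochromatic_triples a (a * M) \<chi>)))
    = 3 / 4 * (n * (n - a)) - (a * \<sigma>) * S / 2 - a * Z / 2 - a * C / 2"
    unfolding count n by (simp add: field_simps)
  also have "\<dots> \<le> 3 / 4 * (n * (n - a)) - (a * \<sigma>) * S / 2 - a * Z / 2 - (S\<^sup>2 - a * n) / 4"
    using corr by (simp add: field_simps)
  also have "\<dots> = n\<^sup>2 - a * n / 2 - ((n - r - m)\<^sup>2 + m * (n - m) + a / 2 * Z)"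
    unfolding S \<sigma> by (simp add: power2_eq_square field_simps)
  finally show ?thesis unfolding Z_def .
qed

text \<open>By antisymmetry \<open>d y\<close> and \<open>d (M - y)\<close> are never both positive, so every index
  \<open>min y (M - y)\<close> is charged at most once.\<close>

lemma sum_antisymmetric_le:
  fixes d w :: "nat \<Rightarrow> real"
  assumes anti: "\<And>y. y \<le> M \<Longrightarrow> d (M - y) = - d y"
    and bound: "\<And>i. 2 * i \<le> M \<Longrightarrow> \<bar>d i\<bar> \<le> w i"
    and B: "B \<subseteq> {1..M}" and J: "finite J" "card J = card B" "\<And>i. i \<in> J \<Longrightarrow> w i \<ge> \<theta>"
    and \<theta>: "\<theta> \<ge> 0" and tail: "\<And>i. 2 * i \<le> M \<Longrightarrow> i \<notin> J \<Longrightarrow> w i \<le> \<theta> \<or> i = 0 \<and> d M \<le> 0"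
  shows "sum d B \<le> sum w J"
proof (rule sum_le_sum_of_largest)
  show "finite B" using B finite_subset by blast
  show "inj_on (\<lambda>y. min y (M - y)) {y \<in> B. \<theta> < d y}"
  proof (rule inj_onI)
    fix x y assume x: "x \<in> {y \<in> B. \<theta> < d y}" and y: "y \<in> {y \<in> B. \<theta> < d y}"
      and eq: "min x (M - x) = min y (M - y)"
    have le: "x \<le> M" "y \<le> M" using x y B by auto
    have "d x > 0" "d y > 0" using x y \<theta> by auto
    then have "y \<noteq> M - x" using anti[OF le(1)] by auto
    then show "x = y" using eq le by linarith
  qed
  fix y assume y: "y \<in> B" "\<theta> < d y"
  then have le: "1 \<le> y" "y \<le> M" using B by auto
  have "d y \<le> \<bar>d (min y (M - y))\<bar>"
    using anti[OF le(2)] by (auto simp: min_def)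
  moreover have "2 * min y (M - y) \<le> M" using le by auto
  ultimately have "d y \<le> w (min y (M - y))" using bound[of "min y (M - y)"] by linarith
  \<comment> \<open>As \<open>y \<ge> 1\<close>, index 0 is charged only by \<open>y = M\<close>,
    hence never when \<open>d M \<le> 0\<close>.\<close>
  moreover have "\<not> (min y (M - y) = 0 \<and> d M \<le> 0)"
  proof
    assume *: "min y (M - y) = 0 \<and> d M \<le> 0"
    then have "y = M" using le by auto
    then show False using * y \<theta> by simp
  qed
  ultimately show "d y \<le> w (min y (M - y)) \<and> (w (min y (M - y)) \<le> \<theta> \<or> min y (M - y) \<in> J)"
    using tail \<open>2 * min y (M - y) \<le> M\<close> by blast
qed (use J in auto)

text \<open>The sum of \<open>s y * d y\<close> is rewritten through the drifts over the rarer
  colour in \<open>{1..M}\<close> alone, since the total of all drifts is known. Bounding them by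
  the largest envelope values gives \<open>I\<close>, bounding each by \<open>n - 2 * l\<close>
  gives \<open>II\<close>.\<close>

lemma multiple_of_a_bound:
  fixes \<chi> :: "nat \<Rightarrow> color" and s :: "nat \<Rightarrow> real"
  assumes a: "a \<ge> 2" and s: "\<And>i. s i = 1 \<or> s i = -1"
    and s_eq: "\<And>i j. \<chi> i = \<chi> j \<longleftrightarrow> s i = s j"
    and n: "n = real (a * M)" and minority: "2 * reds s {1..a * M} \<le> n"
    and M: "M \<ge> 10"
  shows "a * (2 * real (card (non_monochromatic_triples a (a * M) \<chi>))) \<le> n\<^sup>2 - target a n"
proof -
  define r where "r = reds s {1..a * M}"
  define \<mu> where "\<mu> = reds s {1..M}"
  define m where "m = a * \<mu>"
  define d where "d y = drift s (a * M) (a * y)" for y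
  define A where "A = {y \<in> {1..M}. s y = 1}"
  define B where "B = {y \<in> {1..M}. s y = -1}"
  define X where "X = (n - r - m)\<^sup>2 + m * (n - m) + a / 2 * (\<Sum>y=1..M. s y * d y) + a * n / 2"
  have "a * (2 * real (card (non_monochromatic_triples a (a * M) \<chi>))) \<le> n\<^sup>2 - X"
    using non_monochromatic_count_le[of a s \<chi> n M r m, OF _ s s_eq n r_def] a
    by (simp add: X_def d_def m_def \<mu>_def)
  moreover have "target a n \<le> X"
  proof -
    have AB: "{1..M} = A \<union> B" "A \<inter> B = {}" "finite A" "finite B"
      using s by (auto simp: A_def B_def)
    have cardA: "real (card A) = \<mu>" by (simp add: A_def \<mu>_def reds_def)
    have cardB: "real (card B) = M - \<mu>"
    proof -
      have "card A + card B = M"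
        using card_Un_disjoint[OF AB(3,4,2)] by (simp flip: AB(1))
      then show ?thesis using cardA by simp
    qed
    have sumd: "sum d A + sum d B = n - 2 * r"
    proof -
      have "sum d A + sum d B = (\<Sum>y=1..M. d y)"
        unfolding AB(1) using AB by (simp add: sum.union_disjoint)
      also have "\<dots> = - prefix_sum s (a * M)" unfolding d_def by (rule sum_drift_multiples)
      also have "\<dots> = n - 2 * r"
        unfolding prefix_sum_def using sum_eq_reds[of "{1..a * M}" s] s by (simp add: n r_def)
      finally show ?thesis .
    qed
    have Z: "(\<Sum>y=1..M. s y * d y) = sum d A - sum d B"
    proof -
      have "(\<Sum>y=1..M. s y * d y) = (\<Sum>y\<in>A. s y * d y) + (\<Sum>y\<in>B. s y * d y)"
        unfolding AB(1) using AB by (simp add: sum.union_disjoint)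
      then show ?thesis by (simp add: A_def B_def sum_negf)
    qed
    have anti: "d (M - y) = - d y" if "y \<le> M" for y
      using drift_reflect[of "a * y" "a * M" s] that by (simp add: d_def diff_mult_distrib2)
    have dM: "d M \<ge> 0"
      using anti[of M] minority sum_eq_reds[of "{1..a * M}" s] s n
      by (simp add: d_def drift_0 prefix_sum_def)
    have n0: "n \<ge> 20" using a M mult_le_mono[of 2 a 10 M] by (simp add: n flip: of_nat_mult)
    have n4: "n \<ge> 4 * a" using M mult_right_mono[of 4 "real M" "real a"] by (simp add: n mult.commute)
    have M2: "2 * M \<le> a * M" using a by simp
    have "{1..M} \<subseteq> {1..N}" if "2 * M \<le> N" for N using that by auto
    from reds_mono[OF _ this[OF M2], of s] have \<nu>: "r - \<mu> \<ge> 0"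
      by (simp only: r_def \<mu>_def) simp
    have abs_d: "\<bar>d i\<bar> \<le> envelope n l q (a * real i)"
      if "2 * i \<le> M" "2 * l \<le> n - r" "2 * q \<le> n - r"
        "l \<le> \<mu> \<and> q \<le> r - \<mu> \<and> q \<le> real M \<or> 2 * l \<le> r \<and> 2 * q \<le> r" for i l q
      using abs_drift_le_envelope[of s "a * i" "a * M" M l q, OF s _ M2] that mult_le_mono2[OF that(1), of a]
      by (simp add: d_def n r_def \<mu>_def)
    \<comment> \<open>The envelope with \<open>q = 0\<close> is constant \<open>n - 2 * l\<close> up
      to \<open>t = l\<close> and decreases afterwards.\<close>
    have abs_d': "\<bar>d y\<bar> \<le> n - 2 * l" if "y \<le> M" "0 \<le> l" "2 * l \<le> n - r" "l \<le> \<mu> \<or> 2 * l \<le> r" for y l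
    proof -
      have "\<bar>d y\<bar> = \<bar>d (min y (M - y))\<bar>" using anti[OF that(1)] by (auto simp: min_def)
      also have "\<dots> \<le> envelope n l 0 (a * real (min y (M - y)))"
        using that \<nu> reds_nonneg[of s "{1..a * M}"] by (intro abs_d) (auto simp: r_def)
      also have "\<dots> \<le> n - 2 * l" by (simp add: envelope_def max_def)
      finally show ?thesis .
    qed
    show ?thesis
    proof (cases "n \<le> 2 * m")
      case True
      define k where "k = n - m"
      have k: "k = a * real (card B)" by (simp add: k_def m_def cardB n algebra_simps)
      have X: "X = (k - r)\<^sup>2 + k * (n - k) + a * (n - r) - a * sum d B"
      proof -
        have A: "sum d A = n - 2 * r - sum d B" using sumd by simp
        show ?thesis unfolding X_def Z k_def A by (simp add: power2_eq_square field_simps)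
      qed
      show ?thesis
      proof (rule rare_blue_bound)
        fix l q :: real
        assume lq: "0 \<le> l" "0 \<le> q" "2 * l \<le> n - r" "2 * q \<le> n - r" "l \<le> \<mu>" "q \<le> r - \<mu>" "q \<le> M" "l + q \<le> k"
        have "sum d B \<le> (\<Sum>i<card B. envelope n l q (a * real i))"
        proof (rule sum_antisymmetric_le[where M = M and d = d and \<theta> = "n - 2 * k", OF anti])
          show "B \<subseteq> {1..M}" by (auto simp: B_def)
          show "\<bar>d i\<bar> \<le> envelope n l q (a * real i)" if "2 * i \<le> M" for i
            using that lq by (intro abs_d) auto
          show "n - 2 * k \<le> envelope n l q (a * real i)" if "i \<in> {..<card B}" for i
            using that lq a by (intro envelope_ge) (auto simp: k)
          show "envelope n l q (a * real i) \<le> n - 2 * k \<or> i = 0 \<and> d M \<le> 0" if "i \<notin> {..<card B}" for i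
            using that envelope_le[of n l q "a * real i"] mult_left_mono[of "real (card B)" "real i" "real a"]
            by (simp add: k)
        qed (use True in \<open>auto simp: k_def\<close>)
        then have "a * sum d B \<le> a * (\<Sum>i<card B. envelope n l q (a * real i))"
          by (intro mult_left_mono) auto
        also have "\<dots> \<le> n * k - k\<^sup>2 + a * k - (l\<^sup>2 + a * l) - (q\<^sup>2 + a * q)"
          unfolding k using a lq by (intro sum_envelope_le) (auto simp: k)
        finally show "(k - r)\<^sup>2 + l\<^sup>2 + q\<^sup>2 + a * (n - r - k + l + q) \<le> X"
          unfolding X by (simp add: power2_eq_square algebra_simps)
      next
        fix l :: real
        assume l: "0 \<le> l" "2 * l \<le> n - r" "l \<le> \<mu>"
        have "sum d B \<le> card B * (n - 2 * l)"
          using abs_d' l by (intro sum_bounded_above) (force simp: B_def abs_le_iff)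
        then have "a * sum d B \<le> a * (card B * (n - 2 * l))"
          by (intro mult_left_mono) auto
        also have "\<dots> = k * (n - 2 * l)" by (simp add: k)
        finally show "(k - r)\<^sup>2 + 2 * l * k - k\<^sup>2 + a * (n - r) \<le> X"
          unfolding X by (simp add: power2_eq_square algebra_simps)
      next
        show "real a = 2 \<or> 3 \<le> real a" using a by (cases "a = 2") auto
        show "n > 0" using n0 by simp
        show "n - k = a * \<mu>" by (simp add: k_def m_def)
        show "0 \<le> k" by (simp add: k)
      qed (use True minority \<nu> n in \<open>auto simp: k_def r_def mult.commute\<close>)
    next
      case False
      define k where "k = m"
      have k: "k = a * real (card A)" by (simp add: k_def m_def cardA)
      have X: "X = (n - k - r)\<^sup>2 + k * (n - k) + a * r + a * sum d A"
      proof -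
        have B: "sum d B = n - 2 * r - sum d A" using sumd by simp
        show ?thesis unfolding X_def Z k_def B by (simp add: power2_eq_square field_simps)
      qed
      show ?thesis
      proof (rule rare_red_bound)
        fix l q :: real
        assume lq: "0 \<le> l" "0 \<le> q" "2 * l \<le> n - r" "2 * q \<le> n - r"
          "l \<le> \<mu> \<and> q \<le> r - \<mu> \<and> q \<le> M \<or> 2 * l \<le> r \<and> 2 * q \<le> r" "l + q \<le> k"
        let ?w = "\<lambda>i. envelope n l q (a * real i)"
        \<comment> \<open>The drifts enter negated, and \<open>- d M \<le> 0\<close> because red is
          not the majority; so index 0, where the envelope bound is weak, is replaced by
          \<open>card A\<close>.\<close>
        have "(\<Sum>y\<in>A. - d y) \<le> (\<Sum>i=1..card A. ?w i)"
        proof (rule sum_antisymmetric_le[where M = M and \<theta> = "n - 2 * k"])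
          show "A \<subseteq> {1..M}" by (auto simp: A_def)
          show "\<bar>- d i\<bar> \<le> ?w i" if "2 * i \<le> M" for i
            using abs_d[of i l q] that lq by auto
          show "n - 2 * k \<le> ?w i" if "i \<in> {1..card A}" for i
            using that lq a by (intro envelope_ge) (auto simp: k)
          show "?w i \<le> n - 2 * k \<or> i = 0 \<and> - d M \<le> 0" if "i \<notin> {1..card A}" for i
            using that envelope_le[of n l q "a * real i"] dM mult_left_mono[of "real (card A)" "real i" "real a"]
            by (cases "i = 0") (simp_all add: k)
        qed (use False anti in \<open>auto simp: k_def\<close>)
        then have "- (a * sum d A) \<le> a * (\<Sum>i=1..card A. ?w i)"
          using mult_left_mono[of "- sum d A" "\<Sum>i=1..card A. ?w i" "real a"] by (simp add: sum_negf)
        also have "(\<Sum>i=1..card A. ?w i) = (\<Sum>i<card A. ?w i) + ?w (card A) - ?w 0"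
        proof -
          have "(\<Sum>i=1..K. f i) = (\<Sum>i<K. f i) + f K - f 0" for K and f :: "nat \<Rightarrow> real"
            by (induction K) simp_all
          from this[of ?w "card A"] show ?thesis by simp
        qed
        also have "a * \<dots> = a * (\<Sum>i<card A. ?w i) + a * (?w (card A) - ?w 0)"
          by (simp add: algebra_simps)
        also have "\<dots> \<le> (n * k - k\<^sup>2 + a * k - (l\<^sup>2 + a * l) - (q\<^sup>2 + a * q)) + a * (2 * l + 2 * q - 2 * k)"
        proof (rule add_mono)
          show "a * (\<Sum>i<card A. ?w i) \<le> n * k - k\<^sup>2 + a * k - (l\<^sup>2 + a * l) - (q\<^sup>2 + a * q)"
            unfolding k using a lq by (intro sum_envelope_le) (auto simp: k)
          have "?w (card A) - ?w 0 \<le> 2 * l + 2 * q - 2 * k"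
            using envelope_le[of n l q "a * real (card A)"] lq by (simp add: envelope_def k)
          then show "a * (?w (card A) - ?w 0) \<le> a * (2 * l + 2 * q - 2 * k)"
            by (intro mult_left_mono) auto
        qed
        finally show "(n - k - r)\<^sup>2 + l\<^sup>2 + q\<^sup>2 + a * (k + r - l - q) \<le> X"
          unfolding X by (simp add: power2_eq_square algebra_simps)
      next
        fix l :: real
        assume l: "0 \<le> l" "2 * l \<le> n - r" "2 * l \<le> r"
        have "(\<Sum>y\<in>A. - d y) \<le> card A * (n - 2 * l)"
          using abs_d' l by (intro sum_bounded_above) (force simp: A_def abs_le_iff)
        then have "- (a * sum d A) \<le> a * (card A * (n - 2 * l))"
          using mult_left_mono[of "- sum d A" "card A * (n - 2 * l)" "real a"] by (simp add: sum_negf)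
        also have "\<dots> = k * (n - 2 * l)" by (simp add: k)
        finally show "(n - k - r)\<^sup>2 + 2 * l * k - k\<^sup>2 + a * r \<le> X"
          unfolding X by (simp add: power2_eq_square algebra_simps)
      next
        show "real a = 2 \<or> 3 \<le> real a" using a by (cases "a = 2") auto
        show "k = a * \<mu>" by (simp add: k_def m_def)
        show "0 \<le> k" by (simp add: k)
      qed (use False minority \<nu> n n0 n4 in \<open>auto simp: k_def r_def mult.commute\<close>)
    qed
  qed
  ultimately show ?thesis by simp
qed

section \<open>From multiples of \<open>a\<close> to arbitrary \<open>n\<close>\<close>

lemma card_non_monochromatic_triples_add_le:
  assumes "a > 0" "\<rho> < a"
  shows "card (non_monochromatic_triples a (a * M + \<rho>) \<chi>)
    \<le> card (non_monochromatic_triples a (a * M) \<chi>) + \<rho> * M"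
proof -
  \<comment> \<open>A new triple has \<open>z\<close> among the last \<open>\<rho>\<close> numbers
    and is determined by \<open>y\<close> and \<open>z\<close>.\<close>
  let ?E = "(\<lambda>(y, z). (z - a * y, y, z)) ` ({1..M} \<times> {a * M<..a * M + \<rho>})"
  have "non_monochromatic_triples a (a * M + \<rho>) \<chi> \<subseteq> non_monochromatic_triples a (a * M) \<chi> \<union> ?E"
  proof
    fix p assume p: "p \<in> non_monochromatic_triples a (a * M + \<rho>) \<chi>"
    obtain x y z where xyz: "p = (x, y, z)" by (cases p)
    have z: "x + a * y = z" "1 \<le> x" "1 \<le> y" "z \<le> a * M + \<rho>" "\<not> (\<chi> x = \<chi> y \<and> \<chi> y = \<chi> z)"
      using p by (auto simp: xyz non_monochromatic_triples_def)
    have "a * y < a * Suc M" using z assms(2) by simp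
    then have y: "y \<le> M" using \<open>a > 0\<close> by (simp only: mult_less_cancel1 less_Suc_eq_le)
    show "p \<in> non_monochromatic_triples a (a * M) \<chi> \<union> ?E"
    proof (cases "z \<le> a * M")
      case True
      have "M \<le> a * M" using \<open>a > 0\<close> by simp
      then have "x \<le> a * M" "y \<le> a * M" using True z(1) y by linarith+
      then show ?thesis using True z by (auto simp: xyz non_monochromatic_triples_def)
    next
      case False
      then have "(y, z) \<in> {1..M} \<times> {a * M<..a * M + \<rho>}" using y z by simp
      moreover have "p = (\<lambda>(y, z). (z - a * y, y, z)) (y, z)" using z by (auto simp: xyz)
      ultimately show ?thesis by blast
    qed
  qed
  moreover have "finite (non_monochromatic_triples a (a * M) \<chi>)"
    by (rule finite_subset[of _ "{1..a * M} \<times> {1..a * M} \<times> {1..a * M}"])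
      (auto simp: non_monochromatic_triples_def)
  ultimately have "card (non_monochromatic_triples a (a * M + \<rho>) \<chi>)
      \<le> card (non_monochromatic_triples a (a * M) \<chi>) + card ?E"
    by (meson card_Un_le card_mono finite_UnI finite_imageI finite_SigmaI finite_atLeastAtMost
        finite_greaterThanAtMost le_trans)
  also have "card ?E \<le> M * \<rho>"
    by (rule order.trans[OF card_image_le]) (simp_all add: card_cartesian_product)
  finally show ?thesis by (simp add: mult.commute)
qed

text \<open>If the colour \<open>Red\<close> has the majority, all signs are flipped.\<close>

lemma color_signs:
  fixes \<chi> :: "nat \<Rightarrow> color"
  obtains s :: "nat \<Rightarrow> real" where "\<And>i. s i = 1 \<or> s i = -1"
    "\<And>i j. \<chi> i = \<chi> j \<longleftrightarrow> s i = s j" "2 * reds s {1..n} \<le> n"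
proof -
  define s where "s i = (if \<chi> i = Red then 1 else -1 :: real)" for i
  have s: "s i = 1 \<or> s i = -1" for i by (simp add: s_def)
  have eq: "\<chi> i = \<chi> j \<longleftrightarrow> s i = s j" for i j
    by (cases "\<chi> i"; cases "\<chi> j") (simp_all add: s_def)
  show ?thesis
  proof (cases "2 * reds s {1..n} \<le> n")
    case True
    then show ?thesis using that s eq by blast
  next
    case False
    have neg: "- s i = 1 \<or> - s i = -1" for i using s[of i] by auto
    have "2 * reds (\<lambda>i. - s i) {1..n} = n - (2 * reds s {1..n} - n)"
      using sum_eq_reds[of "{1..n}" "\<lambda>i. - s i", OF _ neg] sum_eq_reds[of "{1..n}" s, OF _ s]
      by (simp add: sum_negf)
    then have "2 * reds (\<lambda>i. - s i) {1..n} \<le> n" using False by simp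
    then show ?thesis using that[of "\<lambda>i. - s i"] neg eq by simp
  qed
qed

text \<open>Counting all triples, monochromatic or not, is enough when \<open>M\<close> is small
  compared with \<open>a\<^sup>2\<close>.\<close>

lemma non_monochromatic_count_le_total:
  assumes "a > 0"
  shows "2 * card (non_monochromatic_triples a (a * M) \<chi>) \<le> a * (M * (M - 1))"
proof -
  define E where "E = (SIGMA y:{1..M}. {1..a * M - a * y})"
  have "non_monochromatic_triples a (a * M) \<chi> \<subseteq> (\<lambda>(y, x). (x, y, x + a * y)) ` E"
  proof
    fix p assume p: "p \<in> non_monochromatic_triples a (a * M) \<chi>"
    obtain x y z where xyz: "p = (x, y, z)" by (cases p)
    have z: "z = x + a * y" "1 \<le> x" "1 \<le> y" "z \<le> a * M"
      using p by (auto simp: xyz non_monochromatic_triples_def)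
    have "a * y \<le> a * M" "x \<le> a * M - a * y" using z by linarith+
    then have "(y, x) \<in> E" using z \<open>a > 0\<close> by (simp add: E_def)
    then show "p \<in> (\<lambda>(y, x). (x, y, x + a * y)) ` E" by (force simp: xyz z(1))
  qed
  moreover have "finite E" by (simp add: E_def)
  ultimately have "card (non_monochromatic_triples a (a * M) \<chi>) \<le> card E"
    by (meson card_image_le card_mono finite_imageI le_trans)
  also have "card E = (\<Sum>y=1..M. a * M - a * y)"
    by (simp add: E_def)
  also have "\<dots> = a * (\<Sum>y=1..M. M - y)"
    by (simp add: sum_distrib_left diff_mult_distrib2)
  also have "(\<Sum>y=1..M. M - y) = (\<Sum>y<M. y)"
    by (rule sum.reindex_bij_witness[of _ "\<lambda>y. M - y" "\<lambda>y. M - y"]) auto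
  finally have "2 * card (non_monochromatic_triples a (a * M) \<chi>) \<le> a * (2 * (\<Sum>y<M. y))"
    by simp
  also have "2 * (\<Sum>y<M. y) = M * (M - 1)"
  proof (induction M)
    case (Suc M)
    then show ?case by (cases M) (simp_all add: algebra_simps)
  qed simp
  finally show ?thesis .
qed

theorem theorem3:
  fixes a n :: nat and \<chi> :: "nat \<Rightarrow> color" and Q :: nat
  assumes "a \<ge> 2" and "n \<ge> 1"
    and "Q = 2 * card (non_monochromatic_triples a n \<chi>)"
  shows "real Q \<le> (real n)\<^sup>2 / real a * (1 - 1 / ((real a)\<^sup>2 + 2 * real a + 3))"
proof -
  define M where "M = n div a"
  define \<rho> where "\<rho> = n mod a"
  define D where "D = (real a)\<^sup>2 + 2 * real a + 3"
  define N where "N = real (a * M)"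
  define q where "q = 2 * real (card (non_monochromatic_triples a (a * M) \<chi>))"
  have n: "n = a * M + \<rho>" "\<rho> < a" using \<open>a \<ge> 2\<close> by (auto simp: M_def \<rho>_def)
  have D11: "D \<ge> 11"
    using mult_mono[of 2 "real a" 2 "real a"] \<open>a \<ge> 2\<close> by (simp add: D_def power2_eq_square)
  have "a > 0" using \<open>a \<ge> 2\<close> by simp
  have "real (card (non_monochromatic_triples a n \<chi>))
      \<le> card (non_monochromatic_triples a (a * M) \<chi>) + real \<rho> * M"
    using card_non_monochromatic_triples_add_le[OF \<open>a > 0\<close> n(2), of M \<chi>] unfolding n(1)[symmetric]
    by (simp flip: of_nat_mult of_nat_add)
  then have "real Q \<le> q + 2 * (\<rho> * M)"
    unfolding assms(3) q_def by simp
  then have "a * real Q \<le> a * (q + 2 * (\<rho> * M))"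
    by (intro mult_left_mono) auto
  \<comment> \<open>The remainder costs exactly the cross term of
    \<open>(N + \<rho>)\<^sup>2\<close>, so \<open>\<rho>\<^sup>2\<close> is left to spare.\<close>
  then have Q: "a * real Q \<le> a * q + 2 * \<rho> * N"
    by (simp add: N_def algebra_simps)
  have nN: "real n = N + \<rho>" by (simp add: n(1) N_def)
  have "a * real Q \<le> (real n)\<^sup>2 - (real n)\<^sup>2 / D"
  \<comment> \<open>Up to \<open>D - 2\<close> the saving \<open>a * N\<close> of the count of all
    triples suffices: \<open>N\<^sup>2 \<le> (D - 2) * a * N\<close>, and
    \<open>2 * N * \<rho>\<close> takes the missing \<open>2 * a * N\<close>. Beyond it,
    \<open>M \<ge> 10\<close>.\<close>
  proof (cases "real M \<le> D - 2")
    case True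
    have "real (2 * card (non_monochromatic_triples a (a * M) \<chi>)) \<le> real (a * (M * (M - 1)))"
      using non_monochromatic_count_le_total[OF \<open>a > 0\<close>, of M \<chi>] by (rule of_nat_mono)
    then have "q \<le> a * (real M * (real M - 1))"
      by (cases M) (simp_all add: q_def algebra_simps)
    then have "a * q \<le> a * (a * (real M * (real M - 1)))"
      by (intro mult_left_mono) auto
    also have "\<dots> = N\<^sup>2 - a * N" by (simp add: N_def power2_eq_square algebra_simps)
    finally have q: "a * q \<le> N\<^sup>2 - a * N" .
    have "(real n)\<^sup>2 \<le> D * (\<rho>\<^sup>2 + a * N)"
    proof -
      have "N * N \<le> N * (a * (D - 2))"
        using mult_left_mono[OF True, of "real a"] by (intro mult_left_mono) (auto simp: N_def)
      moreover have "2 * N * \<rho> \<le> 2 * N * a"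
        using n(2) by (intro mult_left_mono) (auto simp: N_def)
      moreover have "1 * (real \<rho>)\<^sup>2 \<le> D * (real \<rho>)\<^sup>2"
        using D11 by (intro mult_right_mono) auto
      ultimately show ?thesis unfolding nN by (simp add: power2_eq_square algebra_simps)
    qed
    then have "(real n)\<^sup>2 / D \<le> \<rho>\<^sup>2 + a * N"
      using D11 by (simp add: divide_le_eq mult.commute)
    then show ?thesis using Q q unfolding nN by (simp add: power2_eq_square algebra_simps)
  next
    case False
    then have "M \<ge> 10" using D11 by simp
    obtain s :: "nat \<Rightarrow> real" where s: "\<And>i. s i = 1 \<or> s i = -1"
      "\<And>i j. \<chi> i = \<chi> j \<longleftrightarrow> s i = s j" "2 * reds s {1..a * M} \<le> real (a * M)"
      by (rule color_signs[of \<chi> "a * M"]) blast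
    have "a * q \<le> N\<^sup>2 - target a N"
      unfolding q_def using s \<open>a \<ge> 2\<close> \<open>M \<ge> 10\<close> by (intro multiple_of_a_bound[of a s]) (auto simp: N_def)
    \<comment> \<open>The second summand of \<open>target\<close> absorbs the cross term
      \<open>2 * N * \<rho>\<close>, because \<open>\<rho> < a\<close>.\<close>
    moreover have "(real n)\<^sup>2 / D \<le> target a N + \<rho>\<^sup>2"
    proof -
      have "2 * N * \<rho> \<le> 2 * N * a"
        using n(2) by (intro mult_left_mono) (auto simp: N_def)
      moreover have "1 * (real \<rho>)\<^sup>2 \<le> D * (real \<rho>)\<^sup>2"
        using D11 by (intro mult_right_mono) auto
      ultimately have "(real n)\<^sup>2 \<le> N\<^sup>2 + 2 * a * N + D * \<rho>\<^sup>2"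
        unfolding nN by (simp add: power2_eq_square algebra_simps)
      then have "(real n)\<^sup>2 / D \<le> (N\<^sup>2 + 2 * a * N + D * \<rho>\<^sup>2) / D"
        using D11 by (intro divide_right_mono) auto
      also have "\<dots> = target a N + \<rho>\<^sup>2"
        using D11 by (simp add: target_def D_def[symmetric] add_divide_distrib)
      finally show ?thesis .
    qed
    ultimately show ?thesis using Q unfolding nN by (simp add: power2_eq_square algebra_simps)
  qed
  then have "real Q \<le> ((real n)\<^sup>2 - (real n)\<^sup>2 / D) / a"
    using \<open>a > 0\<close> by (simp add: pos_le_divide_eq mult.commute)
  also have "\<dots> = (real n)\<^sup>2 / a * (1 - 1 / D)"
    by (simp add: field_simps)
  finally show ?thesis unfolding D_def .
qed

end
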